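(* Let $n,m\ge1$ be integers, let $\phi:\mathbb{C}^n\times\mathbb{C}^n\to\mathbb{C}^m$ be sesquilinear with $\phi(z,z)\in\mathbb{R}^m$ for all $z$, and for $\nu\in S^{m-1}$ let $A_\nu$ be the Hermitian $n\times n$ matrix with $\phi(z,z)\cdot\nu=z^*A_\nu z$. If $m\ge2$ and if the eigenvalues of $A_\nu$ are all nonzero for each $\nu\in S^{m-1}$, then $n$ must be even. Furthermore, for each $\nu\in S^{m-1}$, half of the eigenvalues of $A_\nu$ are positive and half are negative, counting multiplicity.
   Context: $S^{m-1}$ is the unit sphere in $\mathbb{R}^m$. The form $\phi$ defines the quadric $M=\{(z,w)\in\mathbb{C}^n\times\mathbb{C}^m:\operatorname{Im}w=\phi(z,z)\}$, and $z^*A_\nu z$ is its Levi form in the direction $\nu$. *)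

theory Defs
  imports "Jordan_Normal_Form.Schur_Decomposition"
begin

text \<open>Convention: linear in the first argument, conjugate-linear in the second. The opposite
  convention is obtained by exchanging the arguments, which does not affect \<open>\<phi> z z\<close>.\<close>

definition sesquilinear :: "nat \<Rightarrow> nat \<Rightarrow> (complex vec \<Rightarrow> complex vec \<Rightarrow> complex vec) \<Rightarrow> bool" where
  "sesquilinear n m \<phi> \<longleftrightarrow>
     (\<forall>z\<in>carrier_vec n. \<forall>w\<in>carrier_vec n. \<phi> z w \<in> carrier_vec m) \<and>
     (\<forall>z\<in>carrier_vec n. \<forall>z'\<in>carrier_vec n. \<forall>w\<in>carrier_vec n.
        \<phi> (z + z') w = \<phi> z w + \<phi> z' w \<and> \<phi> w (z + z') = \<phi> w z + \<phi> w z') \<and>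
     (\<forall>c. \<forall>z\<in>carrier_vec n. \<forall>w\<in>carrier_vec n.
        \<phi> (c \<cdot>\<^sub>v z) w = c \<cdot>\<^sub>v \<phi> z w \<and> \<phi> z (c \<cdot>\<^sub>v w) = cnj c \<cdot>\<^sub>v \<phi> z w)"

definition unit_sphere :: "nat \<Rightarrow> real vec set" where
  "unit_sphere m = {\<nu> \<in> carrier_vec m. (\<Sum>k<m. (\<nu> $ k)\<^sup>2) = 1}"

definition hermitian_mat :: "complex mat \<Rightarrow> bool" where
  "hermitian_mat A \<longleftrightarrow> square_mat A \<and> mat_adjoint A = A"

text \<open>\<open>A\<close> is the matrix $A_\nu$ of the Levi form in the direction \<open>\<nu>\<close>:
  the Hermitian matrix with $\phi(z,z)\cdot\nu = z^* A z$. If \<open>\<phi>\<close> is sesquilinear and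
  \<open>\<phi> z z\<close> is always real, it exists and is unique, by polarization.\<close>

definition is_levi_matrix ::
  "nat \<Rightarrow> (complex vec \<Rightarrow> complex vec \<Rightarrow> complex vec) \<Rightarrow> real vec \<Rightarrow> complex mat \<Rightarrow> bool" where
  "is_levi_matrix n \<phi> \<nu> A \<longleftrightarrow>
     A \<in> carrier_mat n n \<and> hermitian_mat A \<and>
     (\<forall>z\<in>carrier_vec n.
        \<phi> z z \<bullet> map_vec complex_of_real \<nu> = conjugate z \<bullet> (A *\<^sub>v z))"

text \<open>Counted with algebraic multiplicity.\<close>

definition num_eigenvalues_in :: "complex mat \<Rightarrow> real set \<Rightarrow> nat" where
  "num_eigenvalues_in A S =
     (\<Sum>x | x \<in> S \<and> eigenvalue A (complex_of_real x). Polynomial.order (complex_of_real x) (char_poly A))"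

end

theory Submission
  imports Defs "Jordan_Normal_Form.Jordan_Normal_Form_Existence"
begin

text \<open>The usual argument moves \<open>\<nu>\<close> to \<open>- \<nu>\<close> along the connected sphere: the Levi matrix passes from
  \<open>A\<^sub>\<nu>\<close> to \<open>- A\<^sub>\<nu>\<close> without ever becoming singular, so by continuity of the eigenvalues the number
  of positive ones does not change. The proof below is an algebraic counterpart that stays
  in the plane of two directions and needs no continuity.

  Since \<open>m \<ge> 2\<close>, there is a direction \<open>\<mu>\<close> that is not a multiple of \<open>\<nu>\<close>. Write \<open>A = A\<^sub>\<nu>\<close> and
  \<open>B = A\<^sub>\<mu>\<close>. By polarization the Levi matrix depends linearly on the direction
  (\<open>levi_matrix_linear\<close>), so for each real \<open>x\<close> the matrix \<open>B - x A\<close> is a nonzero multiple of a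
  Levi matrix, and therefore invertible. In other words, \<open>C = A\<inverse> B\<close> has no real eigenvalue.

  Now \<open>C\<close> is self-adjoint for the indefinite Hermitian form of \<open>A\<close>, so two of its generalized
  eigenspaces are orthogonal for this form unless their eigenvalues are conjugate
  (\<open>intertwiner_vanishes\<close>). Consequently the sum of the generalized eigenspaces for the upper
  half-plane is isotropic, and so is the sum for the lower half-plane; together they fill
  the whole space. An isotropic subspace meets the span of the eigenvectors of \<open>A\<close> with positive
  eigenvalues only in \<open>0\<close>, and likewise for negative eigenvalues (\<open>isotropic_card_le\<close>). Adding
  the resulting dimension bounds shows that at most half of the eigenvalues of \<open>A\<close> are positive
  and at most half are negative; as none is zero, both are exactly half
  (\<open>balanced_if_pencil_has_no_real_eigenvalue\<close>).\<close>

section \<open>Adjoints and sesquilinear forms\<close>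

lemma mat_adjoint_carrier [simp]:
  "M \<in> carrier_mat n m \<Longrightarrow> mat_adjoint M \<in> carrier_mat m n"
  unfolding mat_adjoint_def by (auto simp: mat_of_rows_def)

lemma mat_adjoint_index:
  fixes M :: "complex mat"
  assumes "M \<in> carrier_mat n m" "i < m" "j < n"
  shows "mat_adjoint M $$ (i, j) = cnj (M $$ (j, i))"
  using assms unfolding mat_adjoint_def by (auto simp: mat_of_rows_def)

lemma index_mult_mat_sum:
  assumes "M \<in> carrier_mat n k" "N \<in> carrier_mat k m" "i < n" "j < m"
  shows "(M * N) $$ (i, j) = (\<Sum>l<k. M $$ (i, l) * N $$ (l, j))"
  using assms by (auto simp: scalar_prod_def atLeast0LessThan)

lemma index_mult_mat_vec_sum:
  assumes "M \<in> carrier_mat n k" "v \<in> carrier_vec k" "i < n"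
  shows "(M *\<^sub>v v) $ i = (\<Sum>l<k. M $$ (i, l) * v $ l)"
  using assms by (auto simp: scalar_prod_def atLeast0LessThan)

lemma mat_adjoint_mult:
  fixes M N :: "complex mat"
  assumes M: "M \<in> carrier_mat n k" and N: "N \<in> carrier_mat k m"
  shows "mat_adjoint (M * N) = mat_adjoint N * mat_adjoint M"
proof (rule eq_matI)
  have MN: "M * N \<in> carrier_mat n m" using M N by simp
  note aM = mat_adjoint_carrier[OF M] and aN = mat_adjoint_carrier[OF N]
    and aMN = mat_adjoint_carrier[OF MN]
  show "dim_row (mat_adjoint (M * N)) = dim_row (mat_adjoint N * mat_adjoint M)"
    "dim_col (mat_adjoint (M * N)) = dim_col (mat_adjoint N * mat_adjoint M)"
    using aM aN aMN by auto
  fix i j assume "i < dim_row (mat_adjoint N * mat_adjoint M)"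
    "j < dim_col (mat_adjoint N * mat_adjoint M)"
  hence i: "i < m" and j: "j < n" using aM aN by auto
  show "mat_adjoint (M * N) $$ (i, j) = (mat_adjoint N * mat_adjoint M) $$ (i, j)"
    unfolding mat_adjoint_index[OF MN i j] index_mult_mat_sum[OF M N j i] index_mult_mat_sum[OF aN aM i j]
    cnj_sum complex_cnj_mult
  proof (rule sum.cong[OF refl])
    fix l assume "l \<in> {..<k}"
    hence l: "l < k" by simp
    show "cnj (M $$ (j, l)) * cnj (N $$ (l, i)) = mat_adjoint N $$ (i, l) * mat_adjoint M $$ (l, j)"
      by (simp only: mat_adjoint_index[OF M l j] mat_adjoint_index[OF N i l] mult.commute)
  qed
qed

lemma conjugate_mult_mat_vec_scalar_prod:
  fixes P :: "complex mat"
  assumes P: "P \<in> carrier_mat n m" and x: "x \<in> carrier_vec m" and y: "y \<in> carrier_vec n"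
  shows "conjugate (P *\<^sub>v x) \<bullet> y = conjugate x \<bullet> (mat_adjoint P *\<^sub>v y)"
proof -
  note aP = mat_adjoint_carrier[OF P]
  have "conjugate (P *\<^sub>v x) \<bullet> y = (\<Sum>i<n. \<Sum>j<m. cnj (P $$ (i,j)) * cnj (x $ j) * y $ i)"
    using P x y by (simp add: scalar_prod_def atLeast0LessThan sum_distrib_right)
  also have "\<dots> = (\<Sum>j<m. \<Sum>i<n. cnj (P $$ (i,j)) * cnj (x $ j) * y $ i)" by (rule sum.swap)
  also have "\<dots> = (\<Sum>j<m. cnj (x $ j) * (\<Sum>i<n. mat_adjoint P $$ (j, i) * y $ i))"
    by (intro sum.cong refl) (auto simp: sum_distrib_left mat_adjoint_index[OF P] intro!: sum.cong)
  also have "\<dots> = conjugate x \<bullet> (mat_adjoint P *\<^sub>v y)"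
    using aP x y by (simp add: scalar_prod_def atLeast0LessThan)
  finally show ?thesis .
qed

lemma quadratic_form_congruence:
  fixes M P :: "complex mat"
  assumes M: "M \<in> carrier_mat n n" and P: "P \<in> carrier_mat n n"
    and x: "x \<in> carrier_vec n" and y: "y \<in> carrier_vec n"
  shows "conjugate (P *\<^sub>v x) \<bullet> (M *\<^sub>v (P *\<^sub>v y)) = conjugate x \<bullet> ((mat_adjoint P * M * P) *\<^sub>v y)"
proof -
  note aP = mat_adjoint_carrier[OF P]
  have "(mat_adjoint P * M * P) *\<^sub>v y = mat_adjoint P *\<^sub>v (M *\<^sub>v (P *\<^sub>v y))"
    unfolding assoc_mult_mat_vec[OF mult_carrier_mat[OF aP M] P y]
    by (rule assoc_mult_mat_vec[OF aP M mult_mat_vec_carrier[OF P y]])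
  thus ?thesis
    using conjugate_mult_mat_vec_scalar_prod[OF P x mult_mat_vec_carrier[OF M mult_mat_vec_carrier[OF P y]]]
    by simp
qed

lemma quadratic_form_sum:
  fixes M :: "complex mat"
  assumes M: "M \<in> carrier_mat n n" and x: "x \<in> carrier_vec n" and y: "y \<in> carrier_vec n"
  shows "conjugate x \<bullet> (M *\<^sub>v y) = (\<Sum>i<n. \<Sum>j<n. cnj (x $ i) * M $$ (i, j) * y $ j)"
  using assms
  by (simp add: scalar_prod_def atLeast0LessThan sum_distrib_left mult.assoc)

text \<open>Polarization: the diagonal values determine \<open>q x y + q y x\<close>, and
  replacing \<open>y\<close> by \<open>\<i> \<cdot>\<^sub>v y\<close> separates \<open>q x y\<close> from
  \<open>q y x\<close>. This turns linear dependence of the Levi forms on the direction into linear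
  dependence of the matrices.\<close>
lemma zero_quadratic_form:
  fixes M :: "complex mat"
  assumes M: "M \<in> carrier_mat n n"
    and zero: "\<And>z. z \<in> carrier_vec n \<Longrightarrow> conjugate z \<bullet> (M *\<^sub>v z) = 0"
  shows "M = 0\<^sub>m n n"
proof -
  define q where "q x y = conjugate x \<bullet> (M *\<^sub>v y)" for x y
  have add: "q (x + y) (x + y) = q x x + q x y + q y x + q y y"
    if "x \<in> carrier_vec n" "y \<in> carrier_vec n" for x y
    using that M unfolding q_def
    by (simp add: mult_add_distrib_mat_vec[OF M] conjugate_add_vec[of _ n]
        add_scalar_prod_distrib[of _ n] scalar_prod_add_distrib[of _ n])
  have scale: "q x (c \<cdot>\<^sub>v y) = c * q x y" "q (c \<cdot>\<^sub>v y) x = cnj c * q y x"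
    if "x \<in> carrier_vec n" "y \<in> carrier_vec n" for x y c
    using that M unfolding q_def
    by (simp_all add: mult_mat_vec[OF M] conjugate_smult_vec)
  have anti: "q x y + q y x = 0" if "x \<in> carrier_vec n" "y \<in> carrier_vec n" for x y
    using add[OF that] zero[of "x + y"] zero[of x] zero[of y] that by (simp add: q_def)
  have q0: "q x y = 0" if xy: "x \<in> carrier_vec n" "y \<in> carrier_vec n" for x y
  proof -
    have "\<i> * q x y - \<i> * q y x = 0"
      using anti[of x "\<i> \<cdot>\<^sub>v y"] scale[OF xy, of \<i>] xy by simp
    hence "\<i> * (q x y - q y x) = 0" by (simp add: algebra_simps)
    hence "q x y = q y x" by simp
    with anti[OF xy] show ?thesis by simp
  qed
  show ?thesis
  proof (rule eq_matI)
    fix i j assume "i < dim_row (0\<^sub>m n n)" "j < dim_col (0\<^sub>m n n)"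
    hence ij: "i < n" "j < n" by auto
    have "M $$ (i, j) = (M *\<^sub>v unit_vec n j) $ i"
      using M ij by simp
    also have "\<dots> = q (unit_vec n i) (unit_vec n j)"
      using M ij unfolding q_def
      by (simp add: scalar_prod_def[of "conjugate _"] if_distrib[of "\<lambda>x. x * _"] cong: if_cong)
         (simp add: unit_vec_def if_distrib[of cnj] if_distrib[of "\<lambda>x. x * _"] sum.delta cong: if_cong)
    finally show "M $$ (i, j) = 0\<^sub>m n n $$ (i, j)" using q0[of "unit_vec n i" "unit_vec n j"] ij by simp
  qed (use M in auto)
qed

lemma left_inverse_injective:
  fixes P :: "complex mat"
  assumes P: "P \<in> carrier_mat n n" and Q: "Q \<in> carrier_mat n n" and QP: "Q * P = 1\<^sub>m n"
    and v: "v \<in> carrier_vec n" and Pv: "P *\<^sub>v v = 0\<^sub>v n"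
  shows "v = 0\<^sub>v n"
proof -
  have "v = (Q * P) *\<^sub>v v" using QP v by simp
  also have "\<dots> = Q *\<^sub>v (P *\<^sub>v v)" using assoc_mult_mat_vec[OF Q P v] .
  also have "\<dots> = 0\<^sub>v n" unfolding Pv using Q by (intro eq_vecI) auto
  finally show ?thesis .
qed

lemma gram_matrix_definite:
  fixes P :: "complex mat"
  assumes P: "P \<in> carrier_mat n n" and Q: "Q \<in> carrier_mat n n" and QP: "Q * P = 1\<^sub>m n"
    and v: "v \<in> carrier_vec n"
    and zero: "conjugate v \<bullet> ((mat_adjoint P * P) *\<^sub>v v) = 0"
  shows "v = 0\<^sub>v n"
proof -
  have "conjugate (P *\<^sub>v v) \<bullet> (P *\<^sub>v v) = 0"
    using quadratic_form_congruence[OF one_carrier_mat P v v] zero P v mat_adjoint_carrier[OF P] by simp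
  hence "(P *\<^sub>v v) \<bullet>c (P *\<^sub>v v) = 0"
    using conjugate_vec_sprod_comm[of "P *\<^sub>v v" n "P *\<^sub>v v"] P v by simp
  hence "P *\<^sub>v v = 0\<^sub>v n" using conjugate_square_eq_0_vec[of "P *\<^sub>v v" n] P v by simp
  thus ?thesis using left_inverse_injective[OF P Q QP v] by simp
qed

text \<open>Padded with zero rows to a square matrix, the given rows have a last row equal to zero; so no
  vector is mapped to the last unit vector and the matrix has a kernel.\<close>
lemma common_annihilator:
  fixes rs :: "complex Matrix.vec list"
  assumes rs: "set rs \<subseteq> carrier_vec n" and len: "length rs < n"
  shows "\<exists>a\<in>carrier_vec n. a \<noteq> 0\<^sub>v n \<and> (\<forall>r\<in>set rs. r \<bullet> a = 0)"
proof -
  define rs' where "rs' = rs @ replicate (n - length rs) (0\<^sub>v n)"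
  define M where "M = mat_of_rows n rs'"
  have len': "length rs' = n" using len by (simp add: rs'_def)
  have M: "M \<in> carrier_mat n n" unfolding M_def using len' by (auto intro: mat_of_rows_carrier)
  have rs'c: "set rs' \<subseteq> carrier_vec n" using rs by (auto simp: rs'_def)
  have row: "row M i = rs' ! i" if "i < n" for i
    unfolding M_def using that len' rs'c by (intro mat_of_rows_row) auto
  have "det M = 0"
  proof -
    have "row M (n - 1) = 0\<^sub>v n" using row[of "n - 1"] len by (auto simp: rs'_def nth_append)
    hence last: "(M *\<^sub>v v) $ (n - 1) = 0" if "v \<in> carrier_vec n" for v
      using that M len by simp
    show ?thesis
    proof (rule ccontr)
      assume "det M \<noteq> 0"
      then obtain N where N: "N \<in> carrier_mat n n" "M * N = 1\<^sub>m n"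
        using det_non_zero_imp_unit[OF M, of undefined] unfolding Units_def by (auto simp: ring_mat_def)
      have "M *\<^sub>v (N *\<^sub>v unit_vec n (n - 1)) = unit_vec n (n - 1)"
        using assoc_mult_mat_vec[OF M N(1), of "unit_vec n (n - 1)"] N by simp
      thus False using last[of "N *\<^sub>v unit_vec n (n - 1)"] N len by simp
    qed
  qed
  then obtain a where a: "a \<in> carrier_vec n" "a \<noteq> 0\<^sub>v n" "M *\<^sub>v a = 0\<^sub>v n"
    using det_0_iff_vec_prod_zero[OF M] by auto
  have "r \<bullet> a = 0" if "r \<in> set rs" for r
  proof -
    from that obtain i where i: "i < length rs" "r = rs ! i" by (auto simp: in_set_conv_nth)
    have "r \<bullet> a = (M *\<^sub>v a) $ i" using M row[of i] i len by (auto simp: rs'_def nth_append)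
    thus ?thesis using a i len by simp
  qed
  with a show ?thesis by blast
qed

section \<open>Triangular forms that separate eigenvalues\<close>

text \<open>The relevant part of a Jordan normal form: \<open>T\<close> is upper triangular and mixes only basis
  vectors with equal diagonal entry. Thus for any set of eigenvalues, the basis vectors with
  diagonal entry in that set span the sum of the corresponding generalized eigenspaces; the
  exact shape of the blocks is left open.\<close>
definition eigen_triangular :: "nat \<Rightarrow> complex mat \<Rightarrow> bool" where
  "eigen_triangular n T \<longleftrightarrow> T \<in> carrier_mat n n \<and>
     (\<forall>i<n. \<forall>j<n. T $$ (i, j) \<noteq> 0 \<longrightarrow> i \<le> j \<and> T $$ (i, i) = T $$ (j, j))"

lemma eigen_triangular_jordan_matrix:
  "eigen_triangular (sum_list (map fst n_as)) (jordan_matrix n_as)"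
proof (induction n_as)
  case Nil
  show ?case by (auto simp: eigen_triangular_def jordan_matrix_def)
next
  case (Cons na n_as)
  obtain k a where na: "na = (k, a)" by force
  show ?case using Cons jordan_matrix_dim[of n_as]
    unfolding na eigen_triangular_def jordan_matrix_Cons
  proof (auto split: if_splits, goal_cases)
    case (1 i j)
    have "i - k < sum_list (map fst n_as)" "j - k < sum_list (map fst n_as)" using 1(2-5) by linarith+
    hence "i - k \<le> j - k" using 1(1,6) by blast
    thus ?case using 1(2-5) by linarith
  qed
qed

lemma ex_eigen_triangular:
  fixes A :: "complex mat"
  assumes A: "A \<in> carrier_mat n n"
  obtains P Q T where "P \<in> carrier_mat n n" "Q \<in> carrier_mat n n" "P * Q = 1\<^sub>m n" "Q * P = 1\<^sub>m n"
    "eigen_triangular n T" "A * P = P * T" "char_poly A = (\<Prod>i<n. [:- T $$ (i, i), 1:])"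
proof -
  obtain as where "char_poly A = (\<Prod>a\<leftarrow>as. [:- a, 1:])" using char_poly_factorized[OF A] by auto
  then obtain n_as where jnf: "jordan_nf A n_as" using jordan_nf_exists[OF A] by auto
  define T where "T = jordan_matrix n_as"
  from jnf have sim: "similar_mat A T" unfolding jordan_nf_def T_def by auto
  then obtain P Q where wit: "similar_mat_wit A T P Q" unfolding similar_mat_def by auto
  note w = similar_mat_witD2[OF A wit]
  have "sum_list (map fst n_as) = n" using w(5) unfolding T_def carrier_mat_def by simp
  hence eT: "eigen_triangular n T" using eigen_triangular_jordan_matrix[of n_as] by (simp add: T_def)
  have "A * P = P * T * (Q * P)" unfolding w(3) using w by (simp add: assoc_mult_mat[of _ n n _ n _ n])
  hence AP: "A * P = P * T" using w by simp
  have "T $$ (i, j) = 0" if "i < n" "j < i" for i j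
    using eT that unfolding eigen_triangular_def by (metis less_trans linorder_not_less)
  hence ut: "upper_triangular T" using w(5) by (simp add: upper_triangular_def)
  have "char_poly A = char_poly T" by (rule char_poly_similar[OF sim])
  also have "\<dots> = (\<Prod>a\<leftarrow>diag_mat T. [:- a, 1:])" by (rule char_poly_upper_triangular[OF w(5) ut])
  also have "\<dots> = (\<Prod>i<n. [:- T $$ (i, i), 1:])"
    using w(5) by (simp add: diag_mat_def o_def prod.list_conv_set_nth atLeast0LessThan interv_sum_list_conv_sum_set_nat)
  finally show ?thesis using that[OF w(6,7,1,2) eT AP] by blast
qed

section \<open>Orthogonality of generalized eigenspaces\<close>

text \<open>The matrix \<open>C\<close> is self-adjoint for the possibly indefinite form of \<open>H\<close>, because \<open>H * C\<close> is
  Hermitian. In the basis given by the columns of \<open>R\<close> the form has the Gram matrix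
  \<open>mat_adjoint R * H * R\<close> and \<open>C\<close> acts by \<open>S\<close>; the identity expresses self-adjointness there.\<close>
lemma selfadjoint_gram_intertwines:
  fixes H :: "complex mat"
  assumes H: "H \<in> carrier_mat n n" and hH: "mat_adjoint H = H"
    and C: "C \<in> carrier_mat n n" and hHC: "mat_adjoint (H * C) = H * C"
    and R: "R \<in> carrier_mat n n" and S: "S \<in> carrier_mat n n" and CR: "C * R = R * S"
  shows "(mat_adjoint R * H * R) * S = mat_adjoint S * (mat_adjoint R * H * R)"
proof -
  note aR = mat_adjoint_carrier[OF R] and aS = mat_adjoint_carrier[OF S] and aC = mat_adjoint_carrier[OF C]
  have "(mat_adjoint R * H * R) * S = mat_adjoint R * H * (C * R)"
    unfolding CR by (rule assoc_mult_mat[OF mult_carrier_mat[OF aR H] R S])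
  also have "\<dots> = mat_adjoint R * (H * (C * R))"
    by (rule assoc_mult_mat[OF aR H mult_carrier_mat[OF C R]])
  also have "H * (C * R) = mat_adjoint C * H * R"
    unfolding assoc_mult_mat[OF H C R, symmetric]
    using mat_adjoint_mult[OF H C] by (simp add: hH hHC)
  also have "\<dots> = mat_adjoint C * (H * R)" by (rule assoc_mult_mat[OF aC H R])
  also have "mat_adjoint R * \<dots> = mat_adjoint (C * R) * (H * R)"
    unfolding mat_adjoint_mult[OF C R]
    by (rule assoc_mult_mat[OF aR aC mult_carrier_mat[OF H R], symmetric])
  also have "\<dots> = mat_adjoint S * (mat_adjoint R * (H * R))"
    unfolding CR mat_adjoint_mult[OF R S]
    by (rule assoc_mult_mat[OF aS aR mult_carrier_mat[OF H R]])
  also have "mat_adjoint R * (H * R) = mat_adjoint R * H * R"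
    by (rule assoc_mult_mat[OF aR H R, symmetric])
  finally show ?thesis .
qed

text \<open>The special case of the standard inner product.\<close>
lemma hermitian_gram_intertwines:
  fixes A :: "complex mat"
  assumes A: "A \<in> carrier_mat n n" and herm: "mat_adjoint A = A"
    and P: "P \<in> carrier_mat n n" and T: "T \<in> carrier_mat n n" and AP: "A * P = P * T"
  shows "(mat_adjoint P * P) * T = mat_adjoint T * (mat_adjoint P * P)"
proof -
  have "mat_adjoint (1\<^sub>m n :: complex mat) \<in> carrier_mat n n"
    by (rule mat_adjoint_carrier) simp
  from carrier_matD[OF this] have "mat_adjoint (1\<^sub>m n) = (1\<^sub>m n :: complex mat)"
    by (intro eq_matI) (auto simp: mat_adjoint_index[OF one_carrier_mat])
  from selfadjoint_gram_intertwines[OF one_carrier_mat this A _ P T AP] show ?thesis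
    using A herm mat_adjoint_carrier[OF P] by simp
qed

text \<open>Generalized eigenspaces of a self-adjoint operator are orthogonal unless their eigenvalues are
  conjugate. Entry \<open>(i, j)\<close> of the intertwining relation reads
  \<open>G\<^sub>i\<^sub>j * (T\<^sub>j\<^sub>j - cnj T\<^sub>i\<^sub>i)\<close> plus terms in entries of \<open>G\<close> with a smaller index sum. A term
  with a nonzero coefficient belongs to the same pair of eigenvalues, so it vanishes by
  induction.\<close>
lemma intertwiner_vanishes:
  assumes T: "eigen_triangular n T" and G: "G \<in> carrier_mat n n"
    and GT: "G * T = mat_adjoint T * G"
    and ij: "i < n" "j < n" and ne: "cnj (T $$ (i, i)) \<noteq> T $$ (j, j)"
  shows "G $$ (i, j) = 0"
  using ij ne
proof (induction "i + j" arbitrary: i j rule: less_induct)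
  case less
  have Tc: "T \<in> carrier_mat n n" using T by (simp add: eigen_triangular_def)
  have tri: "k < l \<and> T $$ (k, k) = T $$ (l, l)"
    if "k < n" "l < n" "k \<noteq> l" "T $$ (k, l) \<noteq> 0" for k l
    using T that unfolding eigen_triangular_def by (metis le_neq_implies_less)
  have L: "G $$ (i, l) * T $$ (l, j) = 0" if "l \<in> {..<n} - {j}" for l
    using tri[of l j] less that by (cases "T $$ (l, j) = 0") auto
  have R: "cnj (T $$ (l, i)) * G $$ (l, j) = 0" if "l \<in> {..<n} - {i}" for l
    using tri[of l i] less that by (cases "T $$ (l, i) = 0") auto
  have sL: "(\<Sum>l\<in>{..<n} - {j}. G $$ (i, l) * T $$ (l, j)) = 0"
    by (intro sum.neutral ballI L)
  have sR: "(\<Sum>l\<in>{..<n} - {i}. cnj (T $$ (l, i)) * G $$ (l, j)) = 0"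
    by (intro sum.neutral ballI R)
  have "(G * T) $$ (i, j) = (\<Sum>l<n. G $$ (i, l) * T $$ (l, j))"
    by (rule index_mult_mat_sum[OF G Tc less.prems(1,2)])
  also have "\<dots> = G $$ (i, j) * T $$ (j, j)"
    using less.prems sum.remove[of "{..<n}" j "\<lambda>l. G $$ (i, l) * T $$ (l, j)"]
      sL by simp
  finally have 1: "(G * T) $$ (i, j) = G $$ (i, j) * T $$ (j, j)" .
  have "(mat_adjoint T * G) $$ (i, j) = (\<Sum>l<n. cnj (T $$ (l, i)) * G $$ (l, j))"
    using index_mult_mat_sum[OF mat_adjoint_carrier[OF Tc] G less.prems(1,2)] less.prems
    by (simp add: mat_adjoint_index[OF Tc])
  also have "\<dots> = cnj (T $$ (i, i)) * G $$ (i, j)"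
    using less.prems sum.remove[of "{..<n}" i "\<lambda>l. cnj (T $$ (l, i)) * G $$ (l, j)"]
      sR by simp
  finally have "G $$ (i, j) * T $$ (j, j) = cnj (T $$ (i, i)) * G $$ (i, j)"
    unfolding GT[symmetric] 1 .
  moreover have "G $$ (i, j) * (T $$ (j, j) - cnj (T $$ (i, i)))
      = G $$ (i, j) * T $$ (j, j) - cnj (T $$ (i, i)) * G $$ (i, j)" by (simp only: right_diff_distrib mult.commute)
  ultimately have "G $$ (i, j) * (T $$ (j, j) - cnj (T $$ (i, i))) = 0" by (simp only: diff_self)
  thus ?case using less.prems by auto
qed

section \<open>Signature and isotropic subspaces\<close>

text \<open>The spectral theorem, obtained from the definite Gram matrix \<open>G = mat_adjoint P * P\<close>. A nonreal
  \<open>T\<^sub>i\<^sub>i\<close> would force \<open>G\<^sub>i\<^sub>i = 0\<close>. For the second part, let \<open>u\<close> be the off-diagonal part of column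
  \<open>j\<close> of \<open>T\<close>, the earlier columns being diagonal by induction. Then \<open>u\<close> is an eigenvector of \<open>T\<close>
  (if nonzero) that is also of the form \<open>(T - T\<^sub>j\<^sub>j) e\<^sub>j\<close>, and self-adjointness of the shifted
  operator makes \<open>u\<close> orthogonal to itself.\<close>
lemma hermitian_eigen_triangular_diagonal:
  assumes A: "A \<in> carrier_mat n n" and herm: "mat_adjoint A = A"
    and P: "P \<in> carrier_mat n n" and Q: "Q \<in> carrier_mat n n" and QP: "Q * P = 1\<^sub>m n"
    and T: "eigen_triangular n T" and AP: "A * P = P * T"
  shows "\<And>i. i < n \<Longrightarrow> T $$ (i, i) \<in> \<real>"
    and "\<And>i j. i < n \<Longrightarrow> j < n \<Longrightarrow> i \<noteq> j \<Longrightarrow> T $$ (i, j) = 0"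
proof -
  define G where "G = mat_adjoint P * P"
  note aP = mat_adjoint_carrier[OF P]
  have Tc: "T \<in> carrier_mat n n" using T by (simp add: eigen_triangular_def)
  note aT = mat_adjoint_carrier[OF Tc]
  have G: "G \<in> carrier_mat n n" unfolding G_def by (rule mult_carrier_mat[OF aP P])
  have GT: "G * T = mat_adjoint T * G"
    unfolding G_def by (rule hermitian_gram_intertwines[OF A herm P Tc AP])
  have definite: "v = 0\<^sub>v n" if "v \<in> carrier_vec n" "conjugate v \<bullet> (G *\<^sub>v v) = 0" for v
    using gram_matrix_definite[OF P Q QP] that unfolding G_def by blast
  show real: "T $$ (i, i) \<in> \<real>" if i: "i < n" for i
  proof (rule ccontr)
    assume "T $$ (i, i) \<notin> \<real>"
    hence "G $$ (i, i) = 0"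
      using intertwiner_vanishes[OF T G GT i i] by (metis Reals_cnj_iff)
    moreover have "conjugate (unit_vec n i) \<bullet> (G *\<^sub>v unit_vec n i) = G $$ (i, i)"
      using G i
      by (subst quadratic_form_sum[OF G])
         (auto simp: unit_vec_def if_distrib[of cnj] if_distrib[of "\<lambda>x. x * _"] if_distrib[of "\<lambda>x. _ * x"] sum.delta cong: if_cong)
    ultimately have "unit_vec n i = (0\<^sub>v n :: complex Matrix.vec)" using definite[of "unit_vec n i"] by simp
    thus False using i arg_cong[of "unit_vec n i" "0\<^sub>v n :: complex Matrix.vec" "\<lambda>v. v $ i"] by simp
  qed
  show "T $$ (i, j) = 0" if "i < n" "j < n" "i \<noteq> j" for i j
    using that
  proof (induction j arbitrary: i rule: less_induct)
    case (less j)
    define u where "u = Matrix.vec n (\<lambda>l. if l = j then 0 else T $$ (l, j))"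
    have u: "u \<in> carrier_vec n" by (simp add: u_def)
    have below: "l < j \<and> T $$ (l, l) = T $$ (j, j)" if "l < n" "u $ l \<noteq> 0" for l
    proof -
      have lj: "l \<noteq> j" "T $$ (l, j) \<noteq> 0" using that by (auto simp: u_def split: if_splits)
      hence "l \<le> j \<and> T $$ (l, l) = T $$ (j, j)"
        using T that(1) less.prems(2) unfolding eigen_triangular_def by blast
      thus ?thesis using lj by simp
    qed
    \<comment> \<open>Comparing entry \<open>(i, j)\<close> of both sides of the intertwining relation, the two multiples of
      \<open>G\<^sub>i\<^sub>j\<close> cancel because \<open>T\<^sub>i\<^sub>i = T\<^sub>j\<^sub>j\<close> is real; only \<open>(G u)\<^sub>i\<close> is left.\<close>
    have Gu: "(G *\<^sub>v u) $ i = 0" if i: "i < n" "u $ i \<noteq> 0" for i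
    proof -
      have ij: "i < j" "T $$ (i, i) = T $$ (j, j)" using below[OF i] by auto
      have "(G * T) $$ (i, j) = (\<Sum>l<n. G $$ (i, l) * T $$ (l, j))"
        by (rule index_mult_mat_sum[OF G Tc i(1) less.prems(2)])
      also have "\<dots> = G $$ (i, j) * T $$ (j, j) + (\<Sum>l\<in>{..<n}-{j}. G $$ (i, l) * T $$ (l, j))"
        using less.prems by (subst sum.remove[of _ j]) auto
      also have "(\<Sum>l\<in>{..<n}-{j}. G $$ (i, l) * T $$ (l, j)) = (\<Sum>l\<in>{..<n}-{j}. G $$ (i, l) * u $ l)"
        by (intro sum.cong) (auto simp: u_def)
      also have "\<dots> = (\<Sum>l<n. G $$ (i, l) * u $ l)"
        using less.prems by (subst sum.remove[of "{..<n}" j]) (auto simp: u_def)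
      also have "\<dots> = (G *\<^sub>v u) $ i" by (rule index_mult_mat_vec_sum[OF G u i(1), symmetric])
      finally have 1: "(G * T) $$ (i, j) = G $$ (i, j) * T $$ (j, j) + (G *\<^sub>v u) $ i" .
      have "(mat_adjoint T * G) $$ (i, j) = (\<Sum>l<n. cnj (T $$ (l, i)) * G $$ (l, j))"
        using index_mult_mat_sum[OF aT G i(1) less.prems(2)] i by (simp add: mat_adjoint_index[OF Tc])
      also have "\<dots> = cnj (T $$ (i, i)) * G $$ (i, j) + (\<Sum>l\<in>{..<n}-{i}. cnj (T $$ (l, i)) * G $$ (l, j))"
        using i by (subst sum.remove[of _ i]) auto
      also have "(\<Sum>l\<in>{..<n}-{i}. cnj (T $$ (l, i)) * G $$ (l, j)) = 0"
        using less.IH[OF ij(1)] i by (intro sum.neutral) auto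
      also have "cnj (T $$ (i, i)) = T $$ (j, j)" using real[OF i(1)] ij by (simp add: Reals_cnj_iff)
      finally show ?thesis using 1 GT by simp
    qed
    have "conjugate u \<bullet> (G *\<^sub>v u) = (\<Sum>i<n. cnj (u $ i) * (G *\<^sub>v u) $ i)"
      using G u by (simp add: scalar_prod_def atLeast0LessThan)
    also have "\<dots> = 0" using Gu by (intro sum.neutral) fastforce
    finally have "u = 0\<^sub>v n" using definite[OF u] by simp
    hence "u $ i = 0" using less.prems by simp
    thus ?case using less.prems by (simp add: u_def)
  qed
qed

text \<open>The form of \<open>A\<close> is definite on the span of the eigenvectors whose eigenvalues have a fixed sign.
  The eigenvectors need not be orthogonal within an eigenspace, so the Gram matrix \<open>G\<close> is only
  block diagonal; but it commutes with the matrix of the numbers \<open>sqrt \<bar>d i\<bar>\<close>, and scaling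
  \<open>w\<close> by these numbers turns the form of \<open>A\<close>, up to the sign \<open>\<epsilon>\<close>, into the squared norm.\<close>
lemma hermitian_form_definite:
  assumes A: "A \<in> carrier_mat n n"
    and P: "P \<in> carrier_mat n n" and Q: "Q \<in> carrier_mat n n" and QP: "Q * P = 1\<^sub>m n"
    and herm: "mat_adjoint A = A"
    and T: "eigen_triangular n T" and AP: "A * P = P * T"
    and eps: "\<epsilon> \<noteq> 0"
    and w: "w \<in> carrier_vec n"
    and supp: "\<And>i. i < n \<Longrightarrow> w $ i \<noteq> 0 \<Longrightarrow> sgn (Re (T $$ (i, i))) = \<epsilon>"
    and zero: "conjugate (P *\<^sub>v w) \<bullet> (A *\<^sub>v (P *\<^sub>v w)) = 0"
  shows "w = 0\<^sub>v n"
proof -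
  define G where "G = mat_adjoint P * P"
  define d where "d i = Re (T $$ (i, i))" for i
  note aP = mat_adjoint_carrier[OF P]
  have Tc: "T \<in> carrier_mat n n" using T by (simp add: eigen_triangular_def)
  have G: "G \<in> carrier_mat n n" unfolding G_def by (rule mult_carrier_mat[OF aP P])
  note diag = hermitian_eigen_triangular_diagonal[OF A herm P Q QP T AP]
  have Td: "T $$ (i, j) = (if i = j then of_real (d i) else 0)" if "i < n" "j < n" for i j
    using diag that by (auto simp: d_def)
  have GT: "mat_adjoint P * A * P = G * T"
    unfolding assoc_mult_mat[OF aP A P] AP G_def by (rule assoc_mult_mat[OF aP P Tc, symmetric])
  have aGT: "G * T = mat_adjoint T * G"
    unfolding G_def by (rule hermitian_gram_intertwines[OF A herm P Tc AP])
  have block: "d i = d j" if "i < n" "j < n" "G $$ (i, j) \<noteq> 0" for i j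
    using intertwiner_vanishes[OF T G aGT] that Td by (metis complex_cnj_complex_of_real of_real_eq_iff)
  have GTe: "(G * T) $$ (i, j) = G $$ (i, j) * of_real (d j)" if "i < n" "j < n" for i j
  proof -
    have "(G * T) $$ (i, j) = (\<Sum>l<n. if l = j then G $$ (i, j) * of_real (d j) else 0)"
      unfolding index_mult_mat_sum[OF G Tc that] using Td that by (intro sum.cong) auto
    thus ?thesis using that by simp
  qed
  define y where "y = Matrix.vec n (\<lambda>i. of_real (sqrt \<bar>d i\<bar>) * w $ i)"
  have y: "y \<in> carrier_vec n" by (simp add: y_def)
  have "0 = conjugate w \<bullet> ((G * T) *\<^sub>v w)"
    using zero quadratic_form_congruence[OF A P w w] GT by simp
  also have "\<dots> = (\<Sum>i<n. \<Sum>j<n. cnj (w $ i) * (G * T) $$ (i, j) * w $ j)"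
    using G Tc by (intro quadratic_form_sum[OF _ w w]) simp
  also have "\<dots> = (\<Sum>i<n. \<Sum>j<n. of_real \<epsilon> * (cnj (y $ i) * G $$ (i, j) * y $ j))"
  proof (intro sum.cong refl)
    fix i j assume "i \<in> {..<n}" "j \<in> {..<n}"
    hence ij: "i < n" "j < n" by auto
    show "cnj (w $ i) * (G * T) $$ (i, j) * w $ j = of_real \<epsilon> * (cnj (y $ i) * G $$ (i, j) * y $ j)"
    proof (cases "G $$ (i, j) = 0 \<or> w $ j = 0")
      case True
      thus ?thesis using ij by (auto simp: GTe y_def)
    next
      case False
      hence dd: "d i = d j" and s: "sgn (d j) = \<epsilon>" using block[OF ij] supp[of j] ij by (auto simp: d_def)
      have "complex_of_real (sqrt \<bar>d j\<bar>) * of_real (sqrt \<bar>d j\<bar>) = of_real \<bar>d j\<bar>"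
        by (simp flip: of_real_mult)
      moreover have "complex_of_real (d j) = of_real \<epsilon> * of_real \<bar>d j\<bar>"
        using s by (metis of_real_mult sgn_mult_abs)
      ultimately show ?thesis using ij dd by (simp add: GTe y_def algebra_simps)
    qed
  qed
  also have "\<dots> = of_real \<epsilon> * (conjugate y \<bullet> (G *\<^sub>v y))"
    unfolding quadratic_form_sum[OF G y y] by (simp add: sum_distrib_left)
  finally have "conjugate y \<bullet> (G *\<^sub>v y) = 0" using eps by simp
  hence y0: "y = 0\<^sub>v n" using gram_matrix_definite[OF P Q QP y] unfolding G_def by blast
  show ?thesis
  proof (rule eq_vecI)
    fix i assume "i < dim_vec (0\<^sub>v n :: complex Matrix.vec)"
    hence i: "i < n" by simp
    have "y $ i = 0" using y0 i by simp
    hence "complex_of_real (sqrt \<bar>d i\<bar>) * w $ i = 0" using i by (simp add: y_def)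
    thus "w $ i = 0\<^sub>v n $ i" using supp[of i] eps i by (cases "w $ i = 0") (auto simp: d_def)
  qed (use w in simp)
qed

text \<open>An isotropic subspace meets a subspace on which the form is definite only in \<open>0\<close>, so their
  dimensions add up to at most \<open>n\<close>. If they did not, fewer than \<open>n\<close> linear conditions would say
  that \<open>a\<close> is supported on \<open>I\<close> and that \<open>R a\<close> has \<open>P\<close>-coordinates supported on the eigenvectors
  of sign \<open>\<epsilon>\<close>, and a nonzero solution would lie in both subspaces.\<close>
lemma isotropic_card_le:
  assumes A: "A \<in> carrier_mat n n" and herm: "mat_adjoint A = A"
    and P: "P \<in> carrier_mat n n" and Q: "Q \<in> carrier_mat n n"
    and QP: "Q * P = 1\<^sub>m n" and PQ: "P * Q = 1\<^sub>m n"
    and T: "eigen_triangular n T" and AP: "A * P = P * T"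
    and R: "R \<in> carrier_mat n n" and R': "R' \<in> carrier_mat n n" and R'R: "R' * R = 1\<^sub>m n"
    and I: "I \<subseteq> {..<n}"
    and isotropic: "\<And>i j. i \<in> I \<Longrightarrow> j \<in> I \<Longrightarrow> (mat_adjoint R * A * R) $$ (i, j) = 0"
    and eps: "\<epsilon> \<noteq> 0"
  shows "card I + card {i. i < n \<and> sgn (Re (T $$ (i, i))) = \<epsilon>} \<le> n"
proof (rule ccontr)
  define K where "K = {i. i < n \<and> sgn (Re (T $$ (i, i))) = \<epsilon>}"
  assume "\<not> ?thesis"
  hence big: "card I + card K > n" by (simp add: K_def)
  define W where "W = Q * R"
  have W: "W \<in> carrier_mat n n" using Q R by (simp add: W_def)
  define rs where "rs = map (\<lambda>i. unit_vec n i) (sorted_list_of_set ({..<n} - I))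
    @ map (row W) (sorted_list_of_set ({..<n} - K))"
  have KI: "K \<subseteq> {..<n}" by (auto simp: K_def)
  have finI: "finite I" "finite K" using I finite_subset by (auto simp: K_def)
  have cards: "card ({..<n} - I) = n - card I" "card ({..<n} - K) = n - card K"
    using I finI KI by (simp_all add: card_Diff_subset)
  have "card I \<le> n" "card K \<le> n"
    using card_mono[OF _ I] card_mono[of "{..<n}" K] by (auto simp: K_def)
  hence "length rs < n" using big by (simp add: rs_def cards)
  moreover have "set rs \<subseteq> carrier_vec n" using W by (auto simp: rs_def)
  ultimately obtain a where a: "a \<in> carrier_vec n" "a \<noteq> 0\<^sub>v n" and ann: "\<And>r. r \<in> set rs \<Longrightarrow> r \<bullet> a = 0"
    using common_annihilator by blast
  have suppI: "a $ i = 0" if "i < n" "i \<notin> I" for i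
  proof -
    have "unit_vec n i \<bullet> a = 0" by (rule ann) (use that in \<open>auto simp: rs_def\<close>)
    thus ?thesis using a that by simp
  qed
  define w where "w = W *\<^sub>v a"
  have w: "w \<in> carrier_vec n" using W a by (simp add: w_def)
  have "w $ i = 0" if "i < n" "i \<notin> K" for i
  proof -
    have "row W i \<bullet> a = 0" by (rule ann) (use that in \<open>auto simp: rs_def\<close>)
    thus ?thesis using W that by (simp add: w_def)
  qed
  hence suppK: "sgn (Re (T $$ (i, i))) = \<epsilon>" if "i < n" "w $ i \<noteq> 0" for i
    using that by (auto simp: K_def)
  have Qw: "P *\<^sub>v w = R *\<^sub>v a"
  proof -
    have Ra: "R *\<^sub>v a \<in> carrier_vec n" using R a by simp
    have "P *\<^sub>v w = P *\<^sub>v (Q *\<^sub>v (R *\<^sub>v a))" unfolding w_def W_def using assoc_mult_mat_vec[OF Q R a(1)] by simp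
    also have "\<dots> = (P * Q) *\<^sub>v (R *\<^sub>v a)" by (rule assoc_mult_mat_vec[OF P Q Ra, symmetric])
    finally show ?thesis using PQ Ra by simp
  qed
  have H: "mat_adjoint R * A * R \<in> carrier_mat n n" by (rule mult_carrier_mat[OF mult_carrier_mat[OF mat_adjoint_carrier[OF R] A] R])
  have "conjugate (R *\<^sub>v a) \<bullet> (A *\<^sub>v (R *\<^sub>v a))
      = (\<Sum>i<n. \<Sum>j<n. cnj (a $ i) * (mat_adjoint R * A * R) $$ (i, j) * a $ j)"
    unfolding quadratic_form_congruence[OF A R a(1) a(1)] by (rule quadratic_form_sum[OF H a(1) a(1)])
  also have "\<dots> = 0"
  proof (intro sum.neutral ballI)
    fix i j assume "i \<in> {..<n}" "j \<in> {..<n}"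
    thus "cnj (a $ i) * (mat_adjoint R * A * R) $$ (i, j) * a $ j = 0"
      using isotropic[of i j] suppI[of i] suppI[of j] by (cases "i \<in> I"; cases "j \<in> I") auto
  qed
  finally have "w = 0\<^sub>v n"
    using hermitian_form_definite[OF A P Q QP herm T AP eps w suppK] Qw by simp
  moreover have "P *\<^sub>v 0\<^sub>v n = 0\<^sub>v n" using P by (intro eq_vecI) auto
  ultimately have "R *\<^sub>v a = 0\<^sub>v n" using Qw by simp
  thus False using left_inverse_injective[OF R R' R'R a(1)] a(2) by simp
qed

section \<open>Counting eigenvalues with multiplicity\<close>

lemma order_prod_linear_factors:
  fixes c :: "'b \<Rightarrow> 'a::field"
  assumes "finite F"
  shows "Polynomial.order x (\<Prod>i\<in>F. [:- c i, 1:]) = card {i \<in> F. c i = x}"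
  using assms
proof (induction F)
  case (insert k F)
  have lin: "Polynomial.order x [:- c k, 1:] = (if c k = x then 1 else 0)"
    using order_power_n_n[of x 1] by (auto intro: order_0I)
  have "(\<Prod>i\<in>F. [:- c i, 1:]) \<noteq> 0" using insert.hyps(1) by simp
  hence "Polynomial.order x (\<Prod>i\<in>insert k F. [:- c i, 1:])
      = (if c k = x then 1 else 0) + card {i \<in> F. c i = x}"
    using insert by (simp add: order_mult lin del: mult_pCons_left)
  moreover have "{i \<in> insert k F. c i = x} = (if c k = x then insert k {i \<in> F. c i = x} else {i \<in> F. c i = x})"
    by auto
  ultimately show ?case using insert.hyps by simp
qed simp

lemma eigenvalue_iff_linear_factor:
  fixes A :: "complex mat"
  assumes A: "A \<in> carrier_mat n n" and char: "char_poly A = (\<Prod>i<n. [:- c i, 1:])"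
  shows "eigenvalue A x \<longleftrightarrow> (\<exists>i<n. c i = x)"
  unfolding eigenvalue_root_char_poly[OF A] char by (auto simp: poly_prod)

lemma num_eigenvalues_in_card:
  assumes A: "A \<in> carrier_mat n n"
    and char: "char_poly A = (\<Prod>i<n. [:- complex_of_real (d i), 1:])"
  shows "num_eigenvalues_in A S = card {i. i < n \<and> d i \<in> S}"
proof -
  define X where "X = {x \<in> S. \<exists>i<n. d i = x}"
  have "{x. x \<in> S \<and> eigenvalue A (complex_of_real x)} = X"
    unfolding eigenvalue_iff_linear_factor[OF A char] X_def by auto
  hence "num_eigenvalues_in A S = (\<Sum>x\<in>X. card {i \<in> {..<n}. d i = x})"
    unfolding num_eigenvalues_in_def char by (simp add: order_prod_linear_factors)
  also have "\<dots> = card (\<Union>x\<in>X. {i \<in> {..<n}. d i = x})"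
  proof (rule card_UN_disjoint[symmetric])
    have "X \<subseteq> d ` {..<n}" by (auto simp: X_def)
    thus "finite X" by (rule finite_subset) simp
  qed auto
  also have "(\<Union>x\<in>X. {i \<in> {..<n}. d i = x}) = {i. i < n \<and> d i \<in> S}"
    by (auto simp: X_def)
  finally show ?thesis .
qed

lemma eigenvalue_carrierE:
  assumes "eigenvalue M c" and "M \<in> carrier_mat n n"
  obtains v where "v \<in> carrier_vec n" "v \<noteq> 0\<^sub>v n" "M *\<^sub>v v = c \<cdot>\<^sub>v v"
  using assms unfolding eigenvalue_def eigenvector_def by auto

section \<open>Pencils without real eigenvalues\<close>

text \<open>The operator \<open>C = A\<inverse> B\<close> is self-adjoint for the form of \<open>A\<close> and has no real eigenvalue. Hence
  its generalized eigenspaces split into those for the open upper and those for the open lower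
  half-plane. Within one half-plane no two eigenvalues are conjugate, so both parts are isotropic,
  and their dimensions \<open>u\<close> and \<open>l\<close> add up to \<open>n\<close>. With \<open>p\<close> positive and \<open>q\<close> negative
  eigenvalues, \<open>isotropic_card_le\<close> bounds \<open>u + p\<close>, \<open>l + p\<close>, \<open>u + q\<close> and \<open>l + q\<close> by \<open>n\<close>;
  adding in pairs gives \<open>2 * p \<le> n\<close> and \<open>2 * q \<le> n\<close>, while \<open>p + q = n\<close>.\<close>
lemma balanced_if_pencil_has_no_real_eigenvalue:
  assumes A: "A \<in> carrier_mat n n" and hA: "mat_adjoint A = A"
    and B: "B \<in> carrier_mat n n" and hB: "mat_adjoint B = B"
    and regular: "\<And>v. v \<in> carrier_vec n \<Longrightarrow> A *\<^sub>v v = 0\<^sub>v n \<Longrightarrow> v = 0\<^sub>v n"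
    and pencil: "\<And>v x. v \<in> carrier_vec n \<Longrightarrow> B *\<^sub>v v = complex_of_real x \<cdot>\<^sub>v (A *\<^sub>v v) \<Longrightarrow> v = 0\<^sub>v n"
  shows "2 * num_eigenvalues_in A {0<..} = n" and "2 * num_eigenvalues_in A {..<0} = n"
proof -
  have "det A \<noteq> 0" using det_0_iff_vec_prod_zero[OF A] regular by auto
  then obtain N where N: "N \<in> carrier_mat n n" and AN: "A * N = 1\<^sub>m n"
    using det_non_zero_imp_unit[OF A, of undefined] unfolding Units_def by (auto simp: ring_mat_def)
  define C where "C = N * B"
  have C: "C \<in> carrier_mat n n" unfolding C_def by (rule mult_carrier_mat[OF N B])
  have AC: "A * C = B" unfolding C_def assoc_mult_mat[OF A N B, symmetric] AN using B by simp
  obtain R R' S where R: "R \<in> carrier_mat n n" and R': "R' \<in> carrier_mat n n"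
    and "R * R' = 1\<^sub>m n" and R'R: "R' * R = 1\<^sub>m n"
    and S: "eigen_triangular n S" and CR: "C * R = R * S"
    and charC: "char_poly C = (\<Prod>i<n. [:- S $$ (i, i), 1:])"
    by (rule ex_eigen_triangular[OF C])
  have Sc: "S \<in> carrier_mat n n" using S by (simp add: eigen_triangular_def)
  note aR = mat_adjoint_carrier[OF R]
  define G where "G = mat_adjoint R * A * R"
  have G: "G \<in> carrier_mat n n" unfolding G_def by (rule mult_carrier_mat[OF mult_carrier_mat[OF aR A] R])
  have GS: "G * S = mat_adjoint S * G"
    unfolding G_def by (rule selfadjoint_gram_intertwines[OF A hA C _ R Sc CR]) (simp add: AC hB)
  have nonreal: "Im (S $$ (i, i)) \<noteq> 0" if i: "i < n" for i
  proof
    assume "Im (S $$ (i, i)) = 0"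
    then obtain x where x: "S $$ (i, i) = complex_of_real x" by (metis complex_is_Real_iff Reals_cases)
    have "eigenvalue C (S $$ (i, i))" using eigenvalue_iff_linear_factor[OF C charC] i by blast
    then obtain v where v: "v \<in> carrier_vec n" "v \<noteq> 0\<^sub>v n" "C *\<^sub>v v = complex_of_real x \<cdot>\<^sub>v v"
      unfolding x by (rule eigenvalue_carrierE[OF _ C])
    have "B *\<^sub>v v = A *\<^sub>v (C *\<^sub>v v)" unfolding AC[symmetric] by (rule assoc_mult_mat_vec[OF A C v(1)])
    also have "\<dots> = complex_of_real x \<cdot>\<^sub>v (A *\<^sub>v v)" unfolding v(3) by (rule mult_mat_vec[OF A v(1)])
    finally show False using pencil v by blast
  qed
  define U where "U = {i. i < n \<and> Im (S $$ (i, i)) > 0}"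
  define L where "L = {i. i < n \<and> Im (S $$ (i, i)) < 0}"
  have UL: "card U + card L = n"
  proof -
    have "U \<union> L = {..<n}" using nonreal by (force simp: U_def L_def)
    moreover have "card (U \<union> L) = card U + card L"
      by (rule card_Un_disjoint) (auto simp: U_def L_def)
    ultimately show ?thesis by simp
  qed
  have isoU: "G $$ (i, j) = 0" if "i \<in> U" "j \<in> U" for i j
  proof (rule intertwiner_vanishes[OF S G GS])
    show "cnj (S $$ (i, i)) \<noteq> S $$ (j, j)"
    proof
      assume "cnj (S $$ (i, i)) = S $$ (j, j)"
      from arg_cong[OF this, of Im] show False using that by (simp add: U_def)
    qed
  qed (use that in \<open>auto simp: U_def\<close>)
  have isoL: "G $$ (i, j) = 0" if "i \<in> L" "j \<in> L" for i j
  proof (rule intertwiner_vanishes[OF S G GS])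
    show "cnj (S $$ (i, i)) \<noteq> S $$ (j, j)"
    proof
      assume "cnj (S $$ (i, i)) = S $$ (j, j)"
      from arg_cong[OF this, of Im] show False using that by (simp add: L_def)
    qed
  qed (use that in \<open>auto simp: L_def\<close>)
  obtain P Q T where P: "P \<in> carrier_mat n n" and Q: "Q \<in> carrier_mat n n"
    and PQ: "P * Q = 1\<^sub>m n" and QP: "Q * P = 1\<^sub>m n"
    and T: "eigen_triangular n T" and AP: "A * P = P * T"
    and charA: "char_poly A = (\<Prod>i<n. [:- T $$ (i, i), 1:])"
    by (rule ex_eigen_triangular[OF A])
  define d where "d i = Re (T $$ (i, i))" for i
  have Td: "T $$ (i, i) = complex_of_real (d i)" if "i < n" for i
    using hermitian_eigen_triangular_diagonal(1)[OF A hA P Q QP T AP that] by (simp add: d_def)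
  have char: "char_poly A = (\<Prod>i<n. [:- complex_of_real (d i), 1:])"
    unfolding charA using Td by (intro prod.cong) auto
  define K where "K \<epsilon> = {i. i < n \<and> sgn (d i) = \<epsilon>}" for \<epsilon>
  have bound: "card U + card (K \<epsilon>) \<le> n" "card L + card (K \<epsilon>) \<le> n" if "\<epsilon> \<noteq> 0" for \<epsilon>
    unfolding K_def d_def
    by (rule isotropic_card_le[OF A hA P Q QP PQ T AP R R' R'R _ _ that];
        use isoU isoL in \<open>auto simp: G_def U_def L_def\<close>)+
  have nz: "d i \<noteq> 0" if i: "i < n" for i
  proof
    assume "d i = 0"
    hence "eigenvalue A 0" using eigenvalue_iff_linear_factor[OF A char] i by auto
    then obtain v where v: "v \<in> carrier_vec n" "v \<noteq> 0\<^sub>v n" "A *\<^sub>v v = 0 \<cdot>\<^sub>v v"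
      by (rule eigenvalue_carrierE[OF _ A])
    hence "A *\<^sub>v v = 0\<^sub>v n" by (auto intro!: eq_vecI)
    thus False using regular v by blast
  qed
  have sum_K: "card (K 1) + card (K (- 1)) = n"
  proof -
    have "K 1 \<union> K (- 1) = {..<n}" using nz by (force simp: K_def sgn_if)
    moreover have "card (K 1 \<union> K (- 1)) = card (K 1) + card (K (- 1))"
      by (rule card_Un_disjoint) (auto simp: K_def)
    ultimately show ?thesis by simp
  qed
  have halves: "2 * card (K 1) = n" "2 * card (K (- 1)) = n"
    using bound[of 1] bound[of "- 1"] UL sum_K by auto
  have pos: "{i. i < n \<and> d i \<in> {0<..}} = K 1" and neg: "{i. i < n \<and> d i \<in> {..<0}} = K (- 1)"
    by (auto simp: K_def sgn_if split: if_splits)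
  show "2 * num_eigenvalues_in A {0<..} = n" "2 * num_eigenvalues_in A {..<0} = n"
    unfolding num_eigenvalues_in_card[OF A char] pos neg by (rule halves)+
qed

section \<open>Levi matrices\<close>

lemma zero_vec_if_no_zero_eigenvalue:
  fixes M :: "complex mat"
  assumes M: "M \<in> carrier_mat n n" and "\<not> eigenvalue M 0"
    and v: "v \<in> carrier_vec n" and Mv: "M *\<^sub>v v = 0\<^sub>v n"
  shows "v = 0\<^sub>v n"
proof (rule ccontr)
  assume "v \<noteq> 0\<^sub>v n"
  moreover have "M *\<^sub>v v = 0 \<cdot>\<^sub>v v" using Mv v by (auto intro!: eq_vecI)
  ultimately have "eigenvalue M 0" using M v unfolding eigenvalue_def eigenvector_def by auto
  thus False using assms(2) by simp
qed

lemma levi_matrix_linear: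
  assumes \<phi>: "sesquilinear n m \<phi>" and \<nu>: "\<nu> \<in> carrier_vec m" and \<mu>: "\<mu> \<in> carrier_vec m"
    and A: "is_levi_matrix n \<phi> \<nu> A" and B: "is_levi_matrix n \<phi> \<mu> B"
    and M: "is_levi_matrix n \<phi> (a \<cdot>\<^sub>v \<nu> + b \<cdot>\<^sub>v \<mu>) M"
  shows "M = complex_of_real a \<cdot>\<^sub>m A + complex_of_real b \<cdot>\<^sub>m B"
proof -
  let ?N = "complex_of_real a \<cdot>\<^sub>m A + complex_of_real b \<cdot>\<^sub>m B"
  have Ac: "A \<in> carrier_mat n n" and Bc: "B \<in> carrier_mat n n" and Mc: "M \<in> carrier_mat n n"
    using A B M by (auto simp: is_levi_matrix_def)
  have N: "?N \<in> carrier_mat n n" using Ac Bc by simp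
  have "conjugate z \<bullet> ((M - ?N) *\<^sub>v z) = 0" if z: "z \<in> carrier_vec n" for z
  proof -
    have \<phi>z: "\<phi> z z \<in> carrier_vec m" using \<phi> z by (simp add: sesquilinear_def)
    have Mz: "conjugate z \<bullet> (M *\<^sub>v z) = \<phi> z z \<bullet> map_vec complex_of_real (a \<cdot>\<^sub>v \<nu> + b \<cdot>\<^sub>v \<mu>)"
      and Az: "conjugate z \<bullet> (A *\<^sub>v z) = \<phi> z z \<bullet> map_vec complex_of_real \<nu>"
      and Bz: "conjugate z \<bullet> (B *\<^sub>v z) = \<phi> z z \<bullet> map_vec complex_of_real \<mu>"
      using A B M z by (simp_all add: is_levi_matrix_def)
    have "map_vec complex_of_real (a \<cdot>\<^sub>v \<nu> + b \<cdot>\<^sub>v \<mu>)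
        = complex_of_real a \<cdot>\<^sub>v map_vec complex_of_real \<nu> + complex_of_real b \<cdot>\<^sub>v map_vec complex_of_real \<mu>"
      using \<nu> \<mu> by (intro eq_vecI) auto
    hence M_eq: "conjugate z \<bullet> (M *\<^sub>v z) = of_real a * (conjugate z \<bullet> (A *\<^sub>v z)) + of_real b * (conjugate z \<bullet> (B *\<^sub>v z))"
      unfolding Mz Az Bz using \<phi>z \<nu> \<mu> by (simp add: scalar_prod_add_distrib[of _ m])
    have smult: "(c \<cdot>\<^sub>m D) *\<^sub>v z = c \<cdot>\<^sub>v (D *\<^sub>v z)" if "D \<in> carrier_mat n n" for c D
      using that z by (intro eq_vecI) auto
    have N_eq: "conjugate z \<bullet> (?N *\<^sub>v z) = of_real a * (conjugate z \<bullet> (A *\<^sub>v z)) + of_real b * (conjugate z \<bullet> (B *\<^sub>v z))"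
      using Ac Bc z
      by (simp add: add_mult_distrib_mat_vec[of _ n n] smult scalar_prod_add_distrib[of _ n])
    have "(M - ?N) *\<^sub>v z = M *\<^sub>v z - ?N *\<^sub>v z"
      by (rule minus_mult_distrib_mat_vec[OF Mc N z])
    hence "conjugate z \<bullet> ((M - ?N) *\<^sub>v z) = conjugate z \<bullet> (M *\<^sub>v z) - conjugate z \<bullet> (?N *\<^sub>v z)"
      using Mc N z by (simp add: scalar_prod_minus_distrib[of _ n])
    thus ?thesis using M_eq N_eq by simp
  qed
  moreover have MN: "M - ?N \<in> carrier_mat n n" using N by (rule minus_carrier_mat)
  ultimately have D0: "M - ?N = 0\<^sub>m n n" using zero_quadratic_form by blast
  show ?thesis
  proof (rule eq_matI)
    fix i j assume "i < dim_row ?N" "j < dim_col ?N"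
    hence ij: "i < n" "j < n" using N by auto
    hence "(M - ?N) $$ (i, j) = 0" using D0 by simp
    moreover have "(M - ?N) $$ (i, j) = M $$ (i, j) - ?N $$ (i, j)"
      using ij N by (intro index_minus_mat) auto
    ultimately show "M $$ (i, j) = ?N $$ (i, j)" by simp
  qed (use Mc N in auto)
qed

lemma ex_independent_unit_vector:
  assumes m: "m \<ge> 2" and \<nu>: "\<nu> \<in> unit_sphere m"
  obtains \<mu> where "\<mu> \<in> unit_sphere m" "\<And>x. \<mu> \<noteq> x \<cdot>\<^sub>v \<nu>"
proof -
  have c: "\<nu> \<in> carrier_vec m" and s: "(\<Sum>k<m. (\<nu> $ k)\<^sup>2) = 1" using \<nu> by (auto simp: unit_sphere_def)
  obtain i where i: "i < m" "\<nu> $ i \<noteq> 0"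
    using s by (metis (no_types, lifting) lessThan_iff power_zero_numeral sum.neutral zero_neq_one)
  define k where "k = (if i = 0 then 1 else 0 :: nat)"
  have k: "k < m" "k \<noteq> i" using m by (auto simp: k_def)
  have "(\<Sum>l<m. ((unit_vec m k :: real Matrix.vec) $ l)\<^sup>2) = (\<Sum>l<m. if l = k then 1 else 0)"
    by (intro sum.cong) (auto simp: unit_vec_def)
  hence "unit_vec m k \<in> unit_sphere m" using k by (simp add: unit_sphere_def)
  moreover have "unit_vec m k \<noteq> x \<cdot>\<^sub>v \<nu>" for x
  proof
    assume eq: "unit_vec m k = x \<cdot>\<^sub>v \<nu>"
    have "x * \<nu> $ i = 0" using arg_cong[OF eq, of "\<lambda>v. v $ i"] i k c by simp
    hence "x = 0" using i by simp
    thus False using arg_cong[OF eq, of "\<lambda>v. v $ k"] k c by simp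
  qed
  ultimately show ?thesis using that by blast
qed

lemma normalize_in_unit_sphere:
  assumes \<rho>: "\<rho> \<in> carrier_vec m" and nz: "\<rho> \<noteq> 0\<^sub>v m"
  obtains r where "r \<noteq> 0" "r \<cdot>\<^sub>v \<rho> \<in> unit_sphere m"
proof -
  define q where "q = (\<Sum>k<m. (\<rho> $ k)\<^sup>2)"
  have "\<exists>k<m. \<rho> $ k \<noteq> 0" using \<rho> nz by (metis carrier_vecD eq_vecI index_zero_vec(1,2))
  then obtain k where k: "k < m" "\<rho> $ k \<noteq> 0" by blast
  have q: "q > 0" unfolding q_def by (rule sum_pos2[of _ k]) (use k in auto)
  have "(\<Sum>k<m. ((1 / sqrt q) \<cdot>\<^sub>v \<rho>) $ k ^ 2) = (\<Sum>k<m. (\<rho> $ k)\<^sup>2 / q)"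
    using \<rho> q by (intro sum.cong) (auto simp: power_mult_distrib power_divide)
  also have "\<dots> = 1" using q by (simp flip: sum_divide_distrib q_def)
  finally have "(1 / sqrt q) \<cdot>\<^sub>v \<rho> \<in> unit_sphere m" using \<rho> by (simp add: unit_sphere_def)
  thus ?thesis using that[of "1 / sqrt q"] q by simp
qed

section \<open>Nondegenerate Levi forms in every direction\<close>

theorem proposition3p1:
  fixes n m :: nat
    and \<phi> :: "complex Matrix.vec \<Rightarrow> complex Matrix.vec \<Rightarrow> complex Matrix.vec"
    and A :: "real Matrix.vec \<Rightarrow> complex mat"
  assumes "n \<ge> 1" and "m \<ge> 2"
    and "sesquilinear n m \<phi>"
    and "\<And>z k. z \<in> carrier_vec n \<Longrightarrow> k < m \<Longrightarrow> \<phi> z z $ k \<in> \<real>"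
    and "\<And>\<nu>. \<nu> \<in> unit_sphere m \<Longrightarrow> is_levi_matrix n \<phi> \<nu> (A \<nu>)"
    and "\<And>\<nu> c. \<nu> \<in> unit_sphere m \<Longrightarrow> eigenvalue (A \<nu>) c \<Longrightarrow> c \<noteq> 0"
  shows "even n \<and>
    (\<forall>\<nu>\<in>unit_sphere m.
       num_eigenvalues_in (A \<nu>) {0<..} = n div 2 \<and>
       num_eigenvalues_in (A \<nu>) {..<0} = n div 2)"
proof -
  note sesq = assms(3) and levi = assms(5) and nonzero = assms(6)
  have carrier: "A \<nu> \<in> carrier_mat n n" and herm: "mat_adjoint (A \<nu>) = A \<nu>" if "\<nu> \<in> unit_sphere m" for \<nu>
    using levi[OF that] by (auto simp: is_levi_matrix_def hermitian_mat_def)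
  have regular: "v = 0\<^sub>v n"
    if "\<nu> \<in> unit_sphere m" "v \<in> carrier_vec n" "A \<nu> *\<^sub>v v = 0\<^sub>v n" for \<nu> v
    using zero_vec_if_no_zero_eigenvalue[OF carrier[OF that(1)] _ that(2,3)] nonzero[OF that(1)] by blast
  have halves: "2 * num_eigenvalues_in (A \<nu>) {0<..} = n \<and> 2 * num_eigenvalues_in (A \<nu>) {..<0} = n"
    if \<nu>: "\<nu> \<in> unit_sphere m" for \<nu>
  proof -
    obtain \<mu> where \<mu>: "\<mu> \<in> unit_sphere m" and indep: "\<And>x. \<mu> \<noteq> x \<cdot>\<^sub>v \<nu>"
      using ex_independent_unit_vector[OF assms(2) \<nu>] by blast
    have \<nu>c: "\<nu> \<in> carrier_vec m" and \<mu>c: "\<mu> \<in> carrier_vec m" using \<nu> \<mu> by (auto simp: unit_sphere_def)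
    \<comment> \<open>The combination \<open>\<mu> - x \<nu>\<close> is nonzero, so after scaling it is a direction on the sphere,
      and \<open>v\<close> lies in the kernel of its Levi matrix.\<close>
    have pencil: "v = 0\<^sub>v n"
      if v: "v \<in> carrier_vec n" and eq: "A \<mu> *\<^sub>v v = complex_of_real x \<cdot>\<^sub>v (A \<nu> *\<^sub>v v)" for v x
    proof -
      have "\<mu> + (- x) \<cdot>\<^sub>v \<nu> \<noteq> 0\<^sub>v m"
      proof
        assume z: "\<mu> + (- x) \<cdot>\<^sub>v \<nu> = 0\<^sub>v m"
        have "\<mu> = x \<cdot>\<^sub>v \<nu>"
        proof (rule eq_vecI)
          fix i assume "i < dim_vec (x \<cdot>\<^sub>v \<nu>)"
          thus "\<mu> $ i = (x \<cdot>\<^sub>v \<nu>) $ i" using arg_cong[OF z, of "\<lambda>u. u $ i"] \<mu>c \<nu>c by simp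
        qed (use \<mu>c \<nu>c in simp)
        thus False using indep by blast
      qed
      then obtain r where r: "r \<noteq> 0" "r \<cdot>\<^sub>v (\<mu> + (- x) \<cdot>\<^sub>v \<nu>) \<in> unit_sphere m"
        using normalize_in_unit_sphere[of "\<mu> + (- x) \<cdot>\<^sub>v \<nu>" m] \<mu>c \<nu>c by auto
      have "r \<cdot>\<^sub>v (\<mu> + (- x) \<cdot>\<^sub>v \<nu>) = (- (r * x)) \<cdot>\<^sub>v \<nu> + r \<cdot>\<^sub>v \<mu>"
        using \<mu>c \<nu>c by (intro eq_vecI) (auto simp: algebra_simps)
      with r have \<rho>: "(- (r * x)) \<cdot>\<^sub>v \<nu> + r \<cdot>\<^sub>v \<mu> \<in> unit_sphere m" (is "?\<rho> \<in> _") by simp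
      have "A ?\<rho> = complex_of_real (- (r * x)) \<cdot>\<^sub>m A \<nu> + complex_of_real r \<cdot>\<^sub>m A \<mu>"
        by (rule levi_matrix_linear[OF sesq \<nu>c \<mu>c levi[OF \<nu>] levi[OF \<mu>] levi[OF \<rho>]])
      moreover have "(c \<cdot>\<^sub>m D) *\<^sub>v v = c \<cdot>\<^sub>v (D *\<^sub>v v)" if "D \<in> carrier_mat n n" for c and D :: "complex mat"
        using that v by (intro eq_vecI) auto
      ultimately have "A ?\<rho> *\<^sub>v v = complex_of_real (- (r * x)) \<cdot>\<^sub>v (A \<nu> *\<^sub>v v) + complex_of_real r \<cdot>\<^sub>v (A \<mu> *\<^sub>v v)"
        using carrier[OF \<nu>] carrier[OF \<mu>] v by (simp add: add_mult_distrib_mat_vec[of _ n n])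
      also have "\<dots> = 0\<^sub>v n"
        unfolding eq using carrier[OF \<nu>] v by (intro eq_vecI) auto
      finally show ?thesis using regular[OF \<rho> v] by simp
    qed
    note balanced = balanced_if_pencil_has_no_real_eigenvalue[OF carrier[OF \<nu>] herm[OF \<nu>] carrier[OF \<mu>] herm[OF \<mu>]]
    show ?thesis
      by (rule conjI; rule balanced; ((rule regular[OF \<nu>], assumption, assumption) | (rule pencil, assumption, assumption)))
  qed
  obtain \<nu> where "\<nu> \<in> unit_sphere m"
  proof -
    have "(\<Sum>l<m. ((unit_vec m 0 :: real Matrix.vec) $ l)\<^sup>2) = (\<Sum>l<m. if l = 0 then 1 else 0)"
      by (intro sum.cong) (auto simp: unit_vec_def)
    hence "unit_vec m 0 \<in> unit_sphere m" using assms(2) by (simp add: unit_sphere_def)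
    thus ?thesis using that by blast
  qed
  hence "even n" using halves[of \<nu>] by (metis dvd_triv_left)
  thus ?thesis using halves by (metis nonzero_mult_div_cancel_left zero_neq_numeral)
qed

end
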